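(* For every positive integer $m$, every tree that is $m$-universal for the class of trees has at least $\sum_{i=1,\, i\ne 2}^{m}\left\lfloor \frac{m}{i}\right\rfloor$ edges.
   Context: Graphs are finite, undirected and simple. A graph $H$ is a minor of $G$ if $H$ can be obtained from $G$ by successive deletions and/or contractions of edges. A tree $T_{uni}$ is $m$-universal for the class of trees if every tree with $m$ edges is a minor of $T_{uni}$. *)

theory Defs
  imports "Graph_Theory.Graph_Theory"
begin

text \<open>
  A finite simple undirected graph is a \<open>pair_graph\<close> of the library: a finite, loop-free,
  symmetric digraph without parallel arcs. An undirected edge is thus a pair of opposite arcs,
  and counts once.
\<close>

definition uedges :: "'a pair_pre_digraph \<Rightarrow> 'a set set" where
  "uedges G = (\<lambda>(u, v). {u, v}) ` parcs G"

text \<open>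
  The library predicate \<open>tree\<close> is unsuitable here: traversing an edge back and forth is a directed
  cycle of length 2 in a symmetric digraph. The cycles of a simple undirected graph are exactly
  the directed cycles of length at least 3.
\<close>

definition is_tree :: "'a pair_pre_digraph \<Rightarrow> bool" where
  "is_tree T \<longleftrightarrow> pair_graph T \<and> connected (with_proj T) \<and>
     \<not> (\<exists>p. pre_digraph.cycle (with_proj T) p \<and> 3 \<le> length p)"

definition delete_edge :: "'a pair_pre_digraph \<Rightarrow> 'a \<Rightarrow> 'a \<Rightarrow> 'a pair_pre_digraph" where
  "delete_edge G u v = \<lparr>pverts = pverts G, parcs = parcs G - {(u, v), (v, u)}\<rparr>"

text \<open>
  Contracting \<open>{u, v}\<close> merges \<open>v\<close> into \<open>u\<close>. The resulting loop is dropped, and since arcs form a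
  set, parallel edges are identified, so the result is again simple.
\<close>

definition contract_edge :: "'a pair_pre_digraph \<Rightarrow> 'a \<Rightarrow> 'a \<Rightarrow> 'a pair_pre_digraph" where
  "contract_edge G u v =
     (let f = (\<lambda>x. if x = v then u else x)
      in \<lparr>pverts = pverts G - {v}, parcs = {(f x, f y) |x y. (x, y) \<in> parcs G \<and> f x \<noteq> f y}\<rparr>)"

inductive minor_step :: "'a pair_pre_digraph \<Rightarrow> 'a pair_pre_digraph \<Rightarrow> bool" where
  delete: "(u, v) \<in> parcs G \<Longrightarrow> minor_step G (delete_edge G u v)"
| contract: "(u, v) \<in> parcs G \<Longrightarrow> minor_step G (contract_edge G u v)"

definition is_minor :: "'b pair_pre_digraph \<Rightarrow> 'a pair_pre_digraph \<Rightarrow> bool" where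
  "is_minor H G \<longleftrightarrow> (\<exists>K. minor_step\<^sup>*\<^sup>* G K \<and> digraph_iso (with_proj K) (with_proj H))"

text \<open>
  Letting \<open>H\<close> range over graphs on natural numbers is no restriction: every finite graph is
  isomorphic to such a graph, and \<open>is_minor\<close> is invariant under isomorphism.
\<close>

definition universal_for_trees :: "nat \<Rightarrow> 'a pair_pre_digraph \<Rightarrow> bool" where
  "universal_for_trees m T \<longleftrightarrow>
     (\<forall>H :: nat pair_pre_digraph. is_tree H \<and> card (uedges H) = m \<longrightarrow> is_minor H T)"

lemma pair_graph_minor_step:
  assumes "minor_step G K" and "pair_graph G"
  shows "pair_graph K"
proof -
  interpret G: pair_graph G by fact
  have sG: "(y, x) \<in> parcs G" if "(x, y) \<in> parcs G" for x y
    using that G.pair_sym_arcs by (auto simp: symmetric_def dest: symD)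
  have nl: "(x, x) \<notin> parcs G" for x
    using G.pair_no_loops by fastforce
  from \<open>minor_step G K\<close> show ?thesis
  proof cases
    case (delete u v)
    then show ?thesis
      using G.pair_finite_verts G.pair_finite_arcs sG nl
      by unfold_locales
        (auto simp: delete_edge_def symmetric_def sym_def dest: G.in_arcsD1 G.in_arcsD2)
  next
    case (contract u v)
    define f where "f = (\<lambda>x. if x = v then u else x)"
    have K: "pverts K = pverts G - {v}"
      "parcs K = {(f x, f y) |x y. (x, y) \<in> parcs G \<and> f x \<noteq> f y}"
      using contract by (simp_all add: contract_edge_def f_def)
    have uv: "u \<noteq> v" "u \<in> pverts G"
      using contract nl G.in_arcsD1 by auto
    have "parcs K \<subseteq> (\<lambda>(x, y). (f x, f y)) ` parcs G" unfolding K by auto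
    then have "finite (parcs K)" using G.pair_finite_arcs finite_surj by blast
    moreover have "a \<in> pverts K \<and> b \<in> pverts K \<and> a \<noteq> b" if "(a, b) \<in> parcs K" for a b
    proof -
      have "f x \<in> pverts K" if "x \<in> pverts G" for x
        using that uv by (auto simp: K f_def)
      with that show ?thesis
        unfolding K(2) using G.in_arcsD1 G.in_arcsD2 by blast
    qed
    moreover have "sym (parcs K)"
      unfolding K sym_def using sG by fastforce
    moreover have "finite (pverts K)" using G.pair_finite_verts K(1) by simp
    ultimately show ?thesis
      by unfold_locales (auto simp: symmetric_def)
  qed
qed

end

theory Submission
  imports Defs
begin

text \<open>
  Stripping all leaves from a tree is compatible with minors: if \<open>H\<close> is a minor of \<open>T\<close>, then \<open>H\<close>
  without its leaves is a minor of \<open>T\<close> without its leaves. For \<open>i \<le> m div 2\<close> the spider with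
  \<open>m div i \<ge> 2\<close> legs of length at least \<open>i\<close> still contains a star with \<open>m div i\<close> edges after \<open>i - 1\<close>
  rounds of stripping, so \<open>T\<close> loses at least \<open>m div i\<close> leaves, hence as many edges, in round \<open>i\<close>.
  If \<open>m\<close> is odd, the path with \<open>m\<close> edges shows that one more edge survives all \<open>m div 2\<close> rounds.
  Since \<open>m div i = 1\<close> for \<open>i > m div 2\<close>, these bounds sum up to the claim.
\<close>

section \<open>Stripping leaves\<close>

text \<open>Connectedness of the graph induced on \<open>B\<close>, phrased by cuts rather than
  paths, so that proofs extend or restrict a cut. The empty set and singletons qualify
  vacuously.\<close>

definition conn :: "('a \<times> 'a) set \<Rightarrow> 'a set \<Rightarrow> bool" where
  "conn E B \<longleftrightarrow> (\<forall>S. S \<subseteq> B \<longrightarrow> S \<noteq> {} \<longrightarrow> S \<noteq> B \<longrightarrow> (\<exists>x\<in>S. \<exists>y\<in>B - S. (x, y) \<in> E))"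

text \<open>One round of stripping. Isolated vertices go along with the leaves, so in a simple graph
  a lone vertex or a lone edge is stripped to the empty set.\<close>

definition core :: "('a \<times> 'a) set \<Rightarrow> 'a set \<Rightarrow> 'a set" where
  "core E V = {v \<in> V. \<exists>w\<in>V. \<exists>w'\<in>V. w \<noteq> w' \<and> (v, w) \<in> E \<and> (v, w') \<in> E}"

text \<open>The branch sets of the usual model of a minor. The vertex sets are separate from the arc
  sets so that they can shrink under \<open>core\<close> while \<open>F\<close> and \<open>E\<close>
  stay fixed.\<close>

definition minor_model ::
  "('b \<times> 'b) set \<Rightarrow> 'b set \<Rightarrow> ('a \<times> 'a) set \<Rightarrow> 'a set \<Rightarrow> ('b \<Rightarrow> 'a set) \<Rightarrow> bool" where
  "minor_model F W E V B \<longleftrightarrow>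
     (\<forall>x\<in>W. B x \<noteq> {} \<and> B x \<subseteq> V \<and> conn E (B x)) \<and>
     (\<forall>x\<in>W. \<forall>y\<in>W. x \<noteq> y \<longrightarrow> B x \<inter> B y = {}) \<and>
     (\<forall>x\<in>W. \<forall>y\<in>W. x \<noteq> y \<longrightarrow> (x, y) \<in> F \<longrightarrow> (\<exists>a\<in>B x. \<exists>b\<in>B y. (a, b) \<in> E))"

lemma connE:
  assumes "conn E B" "S \<subseteq> B" "x \<in> S" "y \<in> B" "y \<notin> S"
  obtains a b where "a \<in> S" "b \<in> B" "b \<notin> S" "(a, b) \<in> E"
  using assms unfolding conn_def by (metis DiffE empty_iff)

lemma core_subset: "core E V \<subseteq> V"
  by (auto simp: core_def)

lemma coreI:
  "v \<in> V \<Longrightarrow> w \<in> V \<Longrightarrow> w' \<in> V \<Longrightarrow> w \<noteq> w' \<Longrightarrow> (v, w) \<in> E \<Longrightarrow> (v, w') \<in> E \<Longrightarrow> v \<in> core E V"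
  unfolding core_def by blast

lemma core_power_subset: "(core E ^^ n) V \<subseteq> V"
  by (induction n) (use core_subset in fastforce)+

text \<open>A stripped vertex has at most one neighbour in \<open>V\<close>, so no connection
  between surviving vertices depends on it.\<close>

lemma conn_Int_core:
  assumes sym: "sym E" and B: "conn E B" "B \<subseteq> V"
  shows "conn E (B \<inter> core E V)"
  unfolding conn_def
proof (intro allI impI)
  fix S assume S: "S \<subseteq> B \<inter> core E V" "S \<noteq> {}" "S \<noteq> B \<inter> core E V"
  \<comment> \<open>The cut is enlarged by the stripped vertices hanging on it. An arc leaving
    \<open>S'\<close> cannot start at one of these, since its only neighbour lies in
    \<open>S\<close>; so it starts in \<open>S\<close> and ends at a surviving vertex.\<close>
  define S' where "S' = S \<union> {l \<in> B - core E V. \<exists>s\<in>S. (l, s) \<in> E}"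
  obtain x y where "x \<in> S" "y \<in> B \<inter> core E V" "y \<notin> S" using S by blast
  then have "S' \<subseteq> B" "x \<in> S'" "y \<in> B" "y \<notin> S'" using S unfolding S'_def by auto
  with B(1) obtain a b where ab: "a \<in> S'" "b \<in> B" "b \<notin> S'" "(a, b) \<in> E"
    by (rule connE)
  have ba: "(b, a) \<in> E" using sym ab(4) by (rule symD)
  show "\<exists>x\<in>S. \<exists>y\<in>B \<inter> core E V - S. (x, y) \<in> E"
  proof (cases "a \<in> S")
    case True
    then show ?thesis using ab ba unfolding S'_def by blast
  next
    case False
    then obtain s where s: "s \<in> S" "(a, s) \<in> E" "a \<in> B - core E V" using ab(1) S'_def by auto
    then have "b = s" using ab B(2) S(1) coreI[of a V b s E] by auto
    then show ?thesis using s ab S'_def by auto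
  qed
qed

lemma minor_model_subset:
  "minor_model F W E V B \<Longrightarrow> W' \<subseteq> W \<Longrightarrow> minor_model F W' E V B"
  unfolding minor_model_def by (elim conjE, intro conjI) (meson subsetD)+

text \<open>Each branch set is cut down to its surviving vertices. The point is that the ends of
  arcs between branch sets survive when the branch sets belong to vertices of
  \<open>core F W\<close>.\<close>

lemma minor_model_core:
  assumes sym: "sym E" and loop: "irrefl F" and M: "minor_model F W E V B"
  shows "minor_model F (core F W) E (core E V) (\<lambda>x. B x \<inter> core E V)"
proof -
  have V: "B x \<subseteq> V" "conn E (B x)" if "x \<in> W" for x using M that unfolding minor_model_def by auto
  have dj: "B x \<inter> B y = {}" if "x \<in> W" "y \<in> W" "x \<noteq> y" for x y
    using M that unfolding minor_model_def by auto
  have ad: "\<exists>a\<in>B x. \<exists>b\<in>B y. (a, b) \<in> E" if "x \<in> W" "y \<in> W" "(x, y) \<in> F" for x y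
    using M that loop unfolding minor_model_def irrefl_def by metis
  \<comment> \<open>A vertex with an arc out of \<open>B x\<close> has a second neighbour: inside
    \<open>B x\<close> by connectedness or, if \<open>B x\<close> is a singleton, because two
    neighbours of \<open>x\<close> have disjoint branch sets, both adjacent to it.\<close>
  have key: "a \<in> core E V"
    if x: "x \<in> core F W" and a: "a \<in> B x" and b: "b \<in> V" "b \<notin> B x" "(a, b) \<in> E" for x a b
  proof (cases "B x = {a}")
    case True
    obtain w w' where w: "w \<in> W" "w' \<in> W" "w \<noteq> w'" "(x, w) \<in> F" "(x, w') \<in> F" "x \<in> W"
      using x by (auto simp: core_def)
    obtain c c' where c: "c \<in> B w" "c' \<in> B w'" "(a, c) \<in> E" "(a, c') \<in> E"
      using ad[OF w(6,1,4)] ad[OF w(6,2,5)] unfolding True by blast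
    with w dj[of w w'] V(1) a show ?thesis by (intro coreI[of a V c c']) auto
  next
    case False
    have xW: "x \<in> W" using x by (auto simp: core_def)
    obtain d where "d \<in> B x" "d \<noteq> a" using False a by blast
    then obtain a' c where "a' \<in> {a}" "c \<in> B x" "c \<notin> {a}" "(a', c) \<in> E"
      using connE[OF V(2)[OF xW], of "{a}" a d] a by blast
    then show ?thesis using a b V(1)[OF xW] by (intro coreI[of a V b c]) auto
  qed
  have edge: "\<exists>a b. a \<in> B x \<and> b \<in> B y \<and> (a, b) \<in> E \<and> (b, a) \<in> E \<and> a \<notin> B y \<and> b \<notin> B x \<and> a \<in> V \<and> b \<in> V"
    if xy: "x \<in> W" "y \<in> W" "(x, y) \<in> F" "x \<noteq> y" for x y
  proof -
    obtain a b where ab: "a \<in> B x" "b \<in> B y" "(a, b) \<in> E" using ad xy by blast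
    moreover have "(b, a) \<in> E" using sym ab(3) by (rule symD)
    ultimately show ?thesis using dj[OF xy(1,2,4)] V(1) xy by blast
  qed
  show ?thesis unfolding minor_model_def
  proof (intro conjI ballI impI)
    fix x assume x: "x \<in> core F W"
    then obtain w where w: "x \<in> W" "w \<in> W" "(x, w) \<in> F" "x \<noteq> w"
      using loop unfolding core_def irrefl_def by auto
    then show "B x \<inter> core E V \<noteq> {}" using edge[OF w] key[OF x] by blast
    show "conn E (B x \<inter> core E V)"
      using conn_Int_core[OF sym] V w by blast
  next
    fix x y assume xy: "x \<in> core F W" "y \<in> core F W" "x \<noteq> y" "(x, y) \<in> F"
    have W: "x \<in> W" "y \<in> W" using xy core_subset[of F W] by auto
    obtain a b where "a \<in> B x \<and> b \<in> B y \<and> (a, b) \<in> E \<and> (b, a) \<in> E \<and> a \<notin> B y \<and> b \<notin> B x \<and> a \<in> V \<and> b \<in> V"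
      using edge[OF W xy(4,3)] by blast
    then show "\<exists>a\<in>B x \<inter> core E V. \<exists>b\<in>B y \<inter> core E V. (a, b) \<in> E"
      using key[OF xy(1)] key[OF xy(2)] by blast
  next
    fix x y assume "x \<in> core F W" "y \<in> core F W" "x \<noteq> y"
    then show "B x \<inter> core E V \<inter> (B y \<inter> core E V) = {}"
      using dj[of x y] core_subset[of F W] by auto
  qed blast
qed

lemma minor_model_core_power:
  assumes "sym E" "irrefl F" "minor_model F W E V B"
  shows "\<exists>B. minor_model F ((core F ^^ n) W) E ((core E ^^ n) V) B"
  by (induction n) (use assms minor_model_core in \<open>fastforce+\<close>)

lemma conn_core_power:
  assumes "sym E" "conn E V"
  shows "conn E ((core E ^^ n) V)"
proof (induction n)
  case (Suc n)
  then show ?case using conn_Int_core[OF assms(1) Suc order_refl]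
    by (simp add: Int_absorb1[OF core_subset])
qed (simp add: assms)

section \<open>Counting edges\<close>

text \<open>Ordered pairs are counted, so in a simple graph an edge inside \<open>X\<close> adds 2
  to \<open>arc_count E X X\<close>; hence the factors 2 below.\<close>

abbreviation arc_count :: "('a \<times> 'a) set \<Rightarrow> 'a set \<Rightarrow> 'a set \<Rightarrow> nat" where
  "arc_count E X Y \<equiv> card (E \<inter> X \<times> Y)"

lemma arc_count_sum:
  assumes "finite X" "finite Y"
  shows "arc_count E X Y = (\<Sum>x\<in>X. card {y \<in> Y. (x, y) \<in> E})"
proof -
  have "E \<inter> X \<times> Y = Sigma X (\<lambda>x. {y \<in> Y. (x, y) \<in> E})" by auto
  then show ?thesis using assms by simp
qed

lemma arc_count_Un_left:
  assumes "finite X" "finite X'" "finite Y" "X \<inter> X' = {}"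
  shows "arc_count E (X \<union> X') Y = arc_count E X Y + arc_count E X' Y"
  using assms by (simp add: arc_count_sum sum.union_disjoint)

lemma arc_count_swap:
  assumes "sym E"
  shows "arc_count E X Y = arc_count E Y X"
proof -
  have "E \<inter> X \<times> Y = (E \<inter> Y \<times> X)\<inverse>"
    using assms by (auto dest: symD)
  then show ?thesis by simp
qed

lemma arc_count_Un_right:
  assumes "finite X" "finite Y" "finite Y'" "Y \<inter> Y' = {}" "sym E"
  shows "arc_count E X (Y \<union> Y') = arc_count E X Y + arc_count E X Y'"
  using arc_count_Un_left[of Y Y' X E] assms by (simp add: arc_count_swap[of E X])

lemma arc_count_ge_card:
  assumes "finite X" "finite Y" "\<And>x. x \<in> X \<Longrightarrow> \<exists>y\<in>Y. (x, y) \<in> E"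
  shows "card X \<le> arc_count E X Y"
proof -
  have "0 < card {y \<in> Y. (x, y) \<in> E}" if "x \<in> X" for x
    using assms(2) assms(3)[OF that] by (auto simp: card_gt_0_iff)
  then have "(\<Sum>x\<in>X. 1) \<le> (\<Sum>x\<in>X. card {y \<in> Y. (x, y) \<in> E})"
    by (intro sum_mono) (simp add: Suc_leI)
  then show ?thesis using assms by (simp add: arc_count_sum)
qed

text \<open>A subset is grown from a single vertex until it fills \<open>C\<close>; each added
  vertex is joined to an earlier one by an arc in either direction.\<close>

lemma conn_arc_count:
  assumes sym: "sym E" and C: "conn E C" "finite C" "C \<noteq> {}"
  shows "2 * card C \<le> arc_count E C C + 2"
proof -
  have "\<exists>S\<subseteq>C. card S = Suc n \<and> 2 * n \<le> arc_count E S S" if "Suc n \<le> card C" for n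
    using that
  proof (induction n)
    case 0
    obtain x where "x \<in> C" using C by blast
    then show ?case by (intro exI[of _ "{x}"]) auto
  next
    case (Suc n)
    then obtain S where S: "S \<subseteq> C" "card S = Suc n" "2 * n \<le> arc_count E S S" by auto
    have fS: "finite S" using S(1) C(2) finite_subset by blast
    obtain s where "s \<in> S" using S(2) by fastforce
    moreover have "S \<noteq> C" using S(2) Suc.prems by auto
    then obtain c where "c \<in> C" "c \<notin> S" using S(1) by blast
    ultimately obtain x y where xy: "x \<in> S" "y \<in> C" "y \<notin> S" "(x, y) \<in> E"
      using connE[OF C(1) S(1)] by metis
    have yx: "(y, x) \<in> E" using sym xy(4) by (rule symD)
    have "arc_count E (S \<union> {y}) (S \<union> {y})
        = arc_count E S S + arc_count E S {y} + (arc_count E {y} S + arc_count E {y} {y})"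
      using fS xy(3) sym by (simp only: arc_count_Un_left arc_count_Un_right finite_UnI
          finite.intros Int_insert_right Int_empty_right if_False)
    moreover have "1 \<le> arc_count E S {y}"
      using card_mono[of "E \<inter> S \<times> {y}" "{(x, y)}"] xy fS by auto
    moreover have "1 \<le> arc_count E {y} S"
      using card_mono[of "E \<inter> {y} \<times> S" "{(y, x)}"] xy yx fS by auto
    ultimately have "arc_count E S S + 2 \<le> arc_count E (S \<union> {y}) (S \<union> {y})"
      by simp
    then have "2 * Suc n \<le> arc_count E (S \<union> {y}) (S \<union> {y})"
      using S(3) order_trans[of "2 * Suc n" "arc_count E S S + 2"] by simp
    then show ?case
      using S xy fS by (intro exI[of _ "S \<union> {y}"]) auto
  qed
  from this[of "card C - 1"] show ?thesis
    using C card_gt_0_iff[of C] by (auto dest: card_subset_eq[OF C(2)])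
qed

text \<open>
  Outside \<open>C\<close> a tree has as many edges as vertices, so the sum of \<open>2 - degree\<close> over the vertices
  outside \<open>C\<close> is the number of edges leaving \<open>C\<close>; only leaves contribute positively to it.
\<close>
lemma card_leaves_ge:
  assumes sym: "sym E" and V: "finite V" "arc_count E V V + 2 \<le> 2 * card V"
    and nb: "\<And>v. v \<in> V \<Longrightarrow> \<exists>w\<in>V. (v, w) \<in> E"
    and C: "conn E C" "C \<subseteq> V" "C \<noteq> {}"
  shows "arc_count E C (V - C) \<le> card (V - core E V)"
proof -
  define U where "U = V - C"
  have fin: "finite C" "finite U" "C \<inter> U = {}" "V = C \<union> U" "finite (U - core E V)"
    using V C finite_subset unfolding U_def by auto
  have 1: "arc_count E V V = arc_count E C C + arc_count E C U + arc_count E U V"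
    using arc_count_Un_left[of C U V E] arc_count_Un_right[of C C U E] fin sym V(1) by simp
  have cV: "card V = card C + card U" using fin by (simp add: card_Un_disjoint)
  have deg: "2 \<le> card {w \<in> V. (u, w) \<in> E} + (if u \<in> U - core E V then 1 else 0)" if u: "u \<in> U" for u
  proof (cases "u \<in> core E V")
    case True
    then obtain w w' where "w \<in> V" "w' \<in> V" "w \<noteq> w'" "(u, w) \<in> E" "(u, w') \<in> E"
      by (auto simp: core_def)
    then show ?thesis
      using card_mono[of "{w \<in> V. (u, w) \<in> E}" "{w, w'}"] V(1) by auto
  next
    case False
    have "card {w \<in> V. (u, w) \<in> E} > 0" using nb[of u] u V(1) by (auto simp: U_def card_gt_0_iff)
    then show ?thesis using False u by simp
  qed
  have "2 * card U = (\<Sum>u\<in>U. 2)" by simp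
  also have "\<dots> \<le> (\<Sum>u\<in>U. card {w \<in> V. (u, w) \<in> E} + (if u \<in> U - core E V then 1 else 0))"
    using deg by (intro sum_mono) auto
  also have "\<dots> = arc_count E U V + card (U - core E V)"
    unfolding sum.distrib arc_count_sum[OF fin(2) V(1)]
    using fin by (simp add: sum.If_cases Int_def set_diff_eq)
  finally have "2 * card U \<le> arc_count E U V + card (U - core E V)" .
  moreover have "card (U - core E V) \<le> card (V - core E V)"
    using V(1) by (intro card_mono) (auto simp: U_def)
  moreover have "2 * card C \<le> arc_count E C C + 2" using conn_arc_count[OF sym C(1) fin(1) C(3)] .
  ultimately show ?thesis using 1 cV V(2) unfolding U_def[symmetric] by linarith
qed

lemma conn_neighbour:
  assumes "conn E V" "irrefl E" "v \<in> V" "core E V \<noteq> {}"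
  shows "\<exists>w\<in>V. (v, w) \<in> E"
proof -
  obtain w where "w \<in> V" "w \<noteq> v" using assms(4) unfolding core_def by auto
  then show ?thesis using connE[OF assms(1), of "{v}" v w] assms(3) by blast
qed

text \<open>Every stripped vertex is adjacent to a surviving one, so each accounts for a lost edge
  of its own, that is, for two arcs.\<close>

lemma arc_count_core:
  assumes sym: "sym E" and irr: "irrefl E" and V: "finite V" "conn E V" "core E V \<noteq> {}"
  shows "arc_count E (core E V) (core E V) + 2 * card (V - core E V) \<le> arc_count E V V"
proof -
  define D L where "D = core E V" and "L = V - D"
  have fin: "finite D" "finite L" "D \<inter> L = {}" "V = D \<union> L"
    using V(1) core_subset[of E V] finite_subset unfolding D_def L_def by auto
  have "\<exists>d\<in>D. (l, d) \<in> E" if l: "l \<in> L" for l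
  proof -
    obtain w where w: "w \<in> V" "(l, w) \<in> E"
      using conn_neighbour[OF V(2) irr _ V(3)] l unfolding L_def by blast
    \<comment> \<open>Two adjacent stripped vertices have no further neighbours, so
      \<open>{l, w}\<close> would be cut off from the nonempty core.\<close>
    have "w \<in> D"
    proof (rule ccontr)
      assume "w \<notin> D"
      then have wL: "w \<in> L" using w L_def by simp
      obtain d where "d \<in> D" using V(3) D_def by blast
      then have "d \<in> V" "d \<notin> {l, w}" using l wL fin by auto
      then obtain a b where ab: "a \<in> {l, w}" "b \<in> V" "b \<notin> {l, w}" "(a, b) \<in> E"
        using connE[OF V(2), of "{l, w}" l d] l w unfolding L_def by blast
      have "(w, l) \<in> E" using sym w(2) by (rule symD)
      then have "a \<in> D"
        using ab w l coreI[of a V b l E] coreI[of a V b w E] unfolding L_def D_def by auto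
      then show False using ab(1) l wL unfolding L_def by auto
    qed
    then show ?thesis using w by blast
  qed
  then have "card L \<le> arc_count E L D" using arc_count_ge_card fin by blast
  moreover have "arc_count E D L = arc_count E L D" using arc_count_swap[OF sym] .
  moreover have "arc_count E V V
      = arc_count E D D + arc_count E D L + (arc_count E L D + arc_count E L L)"
    using fin sym by (simp add: arc_count_Un_left arc_count_Un_right)
  ultimately show ?thesis unfolding D_def[symmetric] L_def[symmetric] by linarith
qed

section \<open>Branch sets of minors\<close>

text \<open>Deleting an edge keeps the branch sets; contracting one gives \<open>u\<close> the union
  of the two.\<close>

lemma minor_model_step:
  assumes step: "minor_step K K'" and K: "pair_graph K"
    and M: "minor_model (parcs K) (pverts K) E V B"
  shows "\<exists>B'. minor_model (parcs K') (pverts K') E V B'"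
  using step
proof cases
  case (delete u v)
  have "minor_model (parcs K') (pverts K') E V B"
    using M unfolding minor_model_def delete delete_edge_def by simp
  then show ?thesis by blast
next
  case (contract u v)
  interpret pair_graph K by fact
  have uv: "u \<in> pverts K" "v \<in> pverts K" "u \<noteq> v"
    using contract in_arcsD1 in_arcsD2 pair_no_loops by fastforce+
  have V: "B x \<noteq> {}" "B x \<subseteq> V" "conn E (B x)" if "x \<in> pverts K" for x
    using M that unfolding minor_model_def by auto
  have dj: "B x \<inter> B y = {}" if "x \<in> pverts K" "y \<in> pverts K" "x \<noteq> y" for x y
    using M that unfolding minor_model_def by auto
  have ad: "\<exists>a\<in>B x. \<exists>b\<in>B y. (a, b) \<in> E" if "(x, y) \<in> parcs K" for x y
  proof -
    have "x \<in> pverts K" "y \<in> pverts K" "x \<noteq> y"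
      using that in_arcsD1 in_arcsD2 pair_no_loops by fastforce+
    then show ?thesis using M that unfolding minor_model_def by blast
  qed
  have vu: "(v, u) \<in> parcs K" 
    using contract pair_sym_arcs by (auto simp: symmetric_def dest: symD)
  define B' where "B' = B(u := B u \<union> B v)"
  define f where "f = (\<lambda>x. if x = v then u else x)"
  have K': "pverts K' = pverts K - {v}"
      "parcs K' = {(f x, f y) |x y. (x, y) \<in> parcs K \<and> f x \<noteq> f y}"
    using contract by (simp_all add: contract_edge_def f_def)
  have f: "B x \<subseteq> B' (f x)" for x by (auto simp: B'_def f_def)
  \<comment> \<open>A cut of the union either splits one of the two connected sets or separates
    them; in the latter case an arc supplied by the contracted edge crosses it.\<close>
  have "conn E (B u \<union> B v)"
    unfolding conn_def
  proof (intro allI impI)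
    fix S assume S: "S \<subseteq> B u \<union> B v" "S \<noteq> {}" "S \<noteq> B u \<union> B v"
    have cut: "\<exists>x\<in>S. \<exists>y\<in>B u \<union> B v - S. (x, y) \<in> E"
      if w: "conn E (B w)" "B w \<subseteq> B u \<union> B v" "B w \<inter> S \<noteq> {}" "\<not> B w \<subseteq> S" for w
      using w(1)[unfolded conn_def, rule_format, of "B w \<inter> S"] w(2-4) by blast
    show "\<exists>x\<in>S. \<exists>y\<in>B u \<union> B v - S. (x, y) \<in> E"
    proof (cases "(B u \<inter> S \<noteq> {} \<and> \<not> B u \<subseteq> S) \<or> (B v \<inter> S \<noteq> {} \<and> \<not> B v \<subseteq> S)")
      case True
      then show ?thesis using cut[of u] cut[of v] V(3) uv by blast
    next
      case False
      then consider "B u \<subseteq> S" "B v \<inter> S = {}" | "B v \<subseteq> S" "B u \<inter> S = {}"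
        using S by blast
      then show ?thesis using ad[OF contract(2)] ad[OF vu] by cases blast+
    qed
  qed
  then have "minor_model (parcs K') (pverts K') E V B'"
    unfolding minor_model_def
  proof (intro conjI ballI impI)
    fix x y assume "x \<in> pverts K'" "y \<in> pverts K'" "(x, y) \<in> parcs K'"
    then obtain x' y' where "x = f x'" "y = f y'" "(x', y') \<in> parcs K" unfolding K' by blast
    then show "\<exists>a\<in>B' x. \<exists>b\<in>B' y. (a, b) \<in> E" using ad f by blast
  next
    fix x y assume "x \<in> pverts K'" "y \<in> pverts K'" "x \<noteq> y"
    then show "B' x \<inter> B' y = {}"
      using dj[of x y] dj[of x v] dj[of v y] uv unfolding K' B'_def by auto
  qed (use V uv in \<open>auto simp: K' B'_def\<close>)
  then show ?thesis by blast
qed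

lemma minor_model_steps:
  assumes "minor_step\<^sup>*\<^sup>* G K" "pair_graph G"
  shows "pair_graph K \<and> (\<exists>B. minor_model (parcs K) (pverts K) (parcs G) (pverts G) B)"
  using assms(1)
proof induction
  case base
  have "minor_model (parcs G) (pverts G) (parcs G) (pverts G) (\<lambda>x. {x})"
    unfolding minor_model_def conn_def by blast
  then show ?case using assms(2) by blast
next
  case (step K K')
  then show ?case using minor_model_step pair_graph_minor_step by blast
qed

lemma is_minor_imp_minor_model:
  assumes "is_minor H G" "pair_graph G"
  shows "\<exists>B. minor_model (parcs H) (pverts H) (parcs G) (pverts G) B"
proof -
  obtain K h where K: "minor_step\<^sup>*\<^sup>* G K" and h: "pre_digraph.digraph_isomorphism (with_proj K) h"
      "with_proj H = app_iso h (with_proj K)"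
    using assms unfolding is_minor_def digraph_iso_def by auto
  obtain B where B: "minor_model (parcs K) (pverts K) (parcs G) (pverts G) B"
    using minor_model_steps[OF K assms(2)] by blast
  let ?f = "iso_verts h"
  define g where "g = inv_into (pverts K) ?f"
  have inj: "inj_on ?f (pverts K)" and arc: "\<And>e. e \<in> parcs K \<Longrightarrow>
      ?f (fst e) = iso_tail h (iso_arcs h e) \<and> ?f (snd e) = iso_head h (iso_arcs h e)"
    and wf: "wf_digraph (with_proj K)"
    using h(1) unfolding pre_digraph.digraph_isomorphism_def by auto
  \<comment> \<open>Comparing record fields shows that the transported tail and head are again
    \<open>fst\<close> and \<open>snd\<close>, so \<open>h\<close> acts on an arc through its two
    ends.\<close>
  have H: "pverts H = ?f ` pverts K" "parcs H = iso_arcs h ` parcs K"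
    "iso_tail h = fst" "iso_head h = snd"
    using arg_cong[OF h(2), of verts] arg_cong[OF h(2), of arcs]
      arg_cong[OF h(2), of tail] arg_cong[OF h(2), of head] by simp_all
  have gf: "g (?f x) = x" if "x \<in> pverts K" for x
    using inj that unfolding g_def by simp
  have gV: "g x \<in> pverts K" "?f (g x) = x" if "x \<in> pverts H" for x
    using that gf unfolding H by auto
  have gA: "(g x, g y) \<in> parcs K" if xy: "(x, y) \<in> parcs H" for x y
  proof -
    obtain e where e: "e \<in> parcs K" "(x, y) = iso_arcs h e" using xy unfolding H(2) by blast
    have "fst (iso_arcs h e) = ?f (fst e)" "snd (iso_arcs h e) = ?f (snd e)"
      using arc[OF e(1)] H(3,4) by simp_all
    then have "x = ?f (fst e)" "y = ?f (snd e)" unfolding e(2)[symmetric] by simp_all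
    moreover have "fst e \<in> pverts K" "snd e \<in> pverts K"
      using wf_digraph.tail_in_verts[OF wf, of e] wf_digraph.head_in_verts[OF wf, of e] e(1) by auto
    ultimately show ?thesis using gf e(1) by simp
  qed
  have "minor_model (parcs H) (pverts H) (parcs G) (pverts G) (\<lambda>x. B (g x))"
    using B gV gA unfolding minor_model_def by metis
  then show ?thesis by blast
qed

section \<open>Trees\<close>

lemma connected_imp_conn:
  assumes "pair_graph T" "connected (with_proj T)"
  shows "conn (parcs T) (pverts T)" "pverts T \<noteq> {}"
proof -
  interpret pair_graph T by fact
  have sym: "(y, x) \<in> parcs T" if "(x, y) \<in> parcs T" for x y
    using that pair_sym_arcs by (auto simp: symmetric_def dest: symD)
  have arcs: "parcs (mk_symmetric (with_proj T)) = parcs T"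
    using sym by (auto simp: parcs_mk_symmetric)
  have sc: "strongly_connected (mk_symmetric (with_proj T))" using assms(2) unfolding connected_def .
  then show "pverts T \<noteq> {}" unfolding strongly_connected_def by simp
  show "conn (parcs T) (pverts T)"
    unfolding conn_def
  proof (intro allI impI, rule ccontr)
    fix S assume S: "S \<subseteq> pverts T" "S \<noteq> {}" "S \<noteq> pverts T"
      and no: "\<not> (\<exists>x\<in>S. \<exists>y\<in>pverts T - S. (x, y) \<in> parcs T)"
    then obtain x y where x: "x \<in> S" and y: "y \<in> pverts T" "y \<notin> S" by blast
    then have "(x, y) \<in> rtrancl_on (pverts T) (parcs T)"
      using sc S(1) arcs unfolding strongly_connected_def reachable_def by auto
    \<comment> \<open>Without a leaving arc, \<open>S\<close> is closed under reachability.\<close>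
    then have "y \<in> S"
      by (induction rule: rtrancl_on_induct) (use x no in auto)
    with y show False by simp
  qed
qed

lemma pcas_vwalk_arcs: "zs \<noteq> [] \<Longrightarrow> pcas (hd zs) (vwalk_arcs zs) (last zs)"
  by (induction zs rule: vwalk_arcs.induct) auto

lemma pawalk_verts_vwalk_arcs: "zs \<noteq> [] \<Longrightarrow> pawalk_verts (hd zs) (vwalk_arcs zs) = zs"
  by (induction zs rule: vwalk_arcs.induct) auto

text \<open>If every vertex of \<open>S\<close> had two neighbours in \<open>S\<close>, the end of a
  longest path in \<open>S\<close> would lie on a cycle.\<close>

lemma tree_core_neq:
  assumes T: "is_tree T" and S: "finite S" "S \<noteq> {}" "S \<subseteq> pverts T"
  shows "core (parcs T) S \<noteq> S"
proof
  assume core: "core (parcs T) S = S"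
  interpret pair_graph T using T unfolding is_tree_def by simp
  have sym: "(y, x) \<in> parcs T" if "(x, y) \<in> parcs T" for x y
    using that pair_sym_arcs by (auto simp: symmetric_def dest: symD)
  define P where "P = {xs. xs \<noteq> [] \<and> distinct xs \<and> set xs \<subseteq> S \<and> set (vwalk_arcs xs) \<subseteq> parcs T}"
  obtain s where "s \<in> S" using S by blast
  then have "[s] \<in> P" unfolding P_def by simp
  moreover have "length xs \<le> card S" if "xs \<in> P" for xs
    using that S(1) card_mono distinct_card unfolding P_def by (metis (mono_tags) mem_Collect_eq)
  ultimately obtain xs where xs: "xs \<in> P" and max: "\<And>ys. ys \<in> P \<Longrightarrow> length ys \<le> length xs"
    using ex_has_greatest_nat[of "\<lambda>xs. xs \<in> P" "[s]" length "Suc (card S)"]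
    by (metis less_Suc_eq_le)
  then obtain x ys where xys: "xs = x # ys" unfolding P_def by (cases xs) auto
  have in_xs: "w \<in> set ys" if "w \<in> S" "(x, w) \<in> parcs T" for w
  proof (rule ccontr)
    assume "w \<notin> set ys"
    moreover have "w \<noteq> x" using that pair_no_loops by fastforce
    ultimately have "w # xs \<in> P" using xs that sym unfolding P_def xys by auto
    then show False using max[of "w # xs"] by simp
  qed
  have "x \<in> core (parcs T) S" using xs core unfolding P_def xys by simp
  then obtain w1 w2 where "w1 \<noteq> w2" "w1 \<in> S" "w2 \<in> S" "(x, w1) \<in> parcs T" "(x, w2) \<in> parcs T"
    unfolding core_def by auto
  \<comment> \<open>By maximality both neighbours of \<open>x\<close> lie on the path, and one of
    them is not the next vertex \<open>hd ys\<close>; the arc from there back to \<open>x\<close>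
    closes a cycle with at least 3 arcs.\<close>
  then obtain w where w: "w \<in> set ys" "w \<noteq> hd ys" "(x, w) \<in> parcs T"
    using in_xs[of w1] in_xs[of w2] by (cases "w1 = hd ys") auto
  then obtain as bs where ys: "ys = as @ w # bs" by (meson split_list)
  have "as \<noteq> []" using w ys by auto
  define zs where "zs = (x # as @ [w]) @ [x]"
  have arcs: "set (vwalk_arcs zs) \<subseteq> parcs T"
  proof -
    have "set (vwalk_arcs (x # as @ [w])) \<subseteq> set (vwalk_arcs xs)"
      using set_vwalk_arcs_append1[of "x # as @ [w]" bs] unfolding xys ys by simp
    then show ?thesis using xs sym[OF w(3)] unfolding zs_def P_def
      by (subst set_vwalk_arcs_snoc) auto
  qed
  have len: "length (vwalk_arcs zs) = length zs - 1"
    by (rule vwalk_length_simp[of zs, unfolded vwalk_length_def])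
  have zs: "zs \<noteq> []" "hd zs = x" "last zs = x" "distinct (tl zs)"
    using xs unfolding zs_def P_def xys ys by auto
  have "x \<in> pverts T" using xs S(3) unfolding P_def xys by auto
  then have "cycle (vwalk_arcs zs)"
    unfolding cycle_def awalk_def cas_with_proj_eq awalk_verts_with_proj_eq
    using pcas_vwalk_arcs[OF zs(1)] pawalk_verts_vwalk_arcs[OF zs(1)] zs arcs len
    by (intro exI[of _ x]) (auto simp: zs_def)
  moreover have "3 \<le> length (vwalk_arcs zs)"
    unfolding len using \<open>as \<noteq> []\<close> by (cases as) (auto simp: zs_def)
  ultimately show False using T unfolding is_tree_def by blast
qed

text \<open>By \<open>tree_core_neq\<close> some vertex has at most one neighbour in
  \<open>S\<close>; removing it costs at most two arcs.\<close>

lemma tree_arc_count: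
  assumes T: "is_tree T" and S: "finite S" "S \<noteq> {}" "S \<subseteq> pverts T"
  shows "arc_count (parcs T) S S + 2 \<le> 2 * card S"
  using S
proof (induction "card S" arbitrary: S)
  case 0
  then show ?case by simp
next
  case (Suc n)
  interpret pair_graph T using T unfolding is_tree_def by simp
  have sym: "sym (parcs T)" using pair_sym_arcs by (simp add: symmetric_def)
  obtain v where v: "v \<in> S" "v \<notin> core (parcs T) S"
    using tree_core_neq[OF T Suc.prems] core_subset[of "parcs T" S] by blast
  define R where "R = S - {v}"
  have R: "finite R" "S = R \<union> {v}" "R \<inter> {v} = {}" "n = card R" "R \<subseteq> pverts T"
    using v Suc unfolding R_def by auto
  have vv: "parcs T \<inter> {v} \<times> {v} = {}" using pair_no_loops by fastforce
  have count: "arc_count (parcs T) S S = arc_count (parcs T) R R + 2 * arc_count (parcs T) {v} R"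
    using R vv sym arc_count_swap[OF sym, of R "{v}"]
    by (simp add: arc_count_Un_left arc_count_Un_right del: Un_insert_right Un_insert_left)
  have "arc_count (parcs T) {v} R \<le> 1"
  proof -
    have "a = b" if "a \<in> parcs T \<inter> {v} \<times> R" "b \<in> parcs T \<inter> {v} \<times> R" for a b
      using that v coreI[of v S "snd a" "snd b" "parcs T"] R_def by auto
    then have "\<forall>a\<in>parcs T \<inter> {v} \<times> R. \<forall>b\<in>parcs T \<inter> {v} \<times> R. a = b" by blast
    moreover have "finite (parcs T \<inter> {v} \<times> R)" using R(1) by simp
    ultimately show ?thesis using card_le_Suc0_iff_eq[of "parcs T \<inter> {v} \<times> R"] by simp
  qed
  moreover have "arc_count (parcs T) R R + 2 \<le> 2 * card R" if "R \<noteq> {}"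
    using Suc.hyps(1)[OF R(4,1) that R(5)] .
  ultimately show ?case
    using count R Suc.hyps(2) by (cases "R = {}") auto
qed

section \<open>Spiders\<close>

text \<open>Vertex 0 is the root and \<open>p\<close> the parent map. With \<open>p v < v\<close>
  for positive \<open>v\<close>, acyclicity, connectedness and the edge count are all read off the
  order of the labels.\<close>

definition parent_tree :: "(nat \<Rightarrow> nat) \<Rightarrow> nat \<Rightarrow> nat pair_pre_digraph" where
  "parent_tree p m = \<lparr>pverts = {..m},
     parcs = {(a, b). (0 < a \<and> a \<le> m \<and> b = p a) \<or> (0 < b \<and> b \<le> m \<and> a = p b)}\<rparr>"

lemma pawalk_verts_pcas: "pcas u es v \<Longrightarrow> pawalk_verts u es = u # map snd es"
  by (induction es arbitrary: u) auto

lemma pcas_nth: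
  assumes "pcas u es v" "es \<noteq> []"
  shows "fst (es ! 0) = u \<and> snd (es ! (length es - 1)) = v \<and>
    (\<forall>i. Suc i < length es \<longrightarrow> snd (es ! i) = fst (es ! Suc i))"
  using assms
proof (induction es arbitrary: u)
  case (Cons e es)
  show ?case
  proof (cases "es = []")
    case False
    then have IH: "fst (es ! 0) = snd e" "snd (es ! (length es - 1)) = v"
      "\<And>i. Suc i < length es \<Longrightarrow> snd (es ! i) = fst (es ! Suc i)"
      using Cons by auto
    then have "snd ((e # es) ! i) = fst ((e # es) ! Suc i)" if "Suc i < length (e # es)" for i
      using that by (cases i) auto
    then show ?thesis using Cons.prems IH False by auto
  qed (use Cons in auto)
qed simp

text \<open>At its largest vertex a cycle would have to enter and leave through the parent.\<close>
lemma parent_tree_acyclic: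
  assumes p: "\<And>v. 0 < v \<Longrightarrow> p v < v"
    and c: "pre_digraph.cycle (with_proj (parent_tree p m)) es"
  shows "length es < 3"
proof (rule ccontr)
  assume "\<not> length es < 3"
  define n where "n = length es"
  have n: "3 \<le> n" "es \<noteq> []" using \<open>\<not> length es < 3\<close> unfolding n_def by auto
  obtain u where u: "set es \<subseteq> parcs (parent_tree p m)" "pcas u es u" "distinct (tl (pawalk_verts u es))"
    using c unfolding pre_digraph.cycle_def pre_digraph.awalk_def
      cas_with_proj_eq awalk_verts_with_proj_eq by auto
  have dist: "distinct (map snd es)" using u(3) pawalk_verts_pcas[OF u(2)] by simp
  \<comment> \<open>Cyclic successor of a position on the closed walk; \<open>j\<close> below is the
    predecessor of \<open>i\<close>.\<close>
  define next_ind where "next_ind i = (if Suc i = n then 0 else Suc i)" for i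
  have succ: "snd (es ! i) = fst (es ! next_ind i)" "next_ind i < n" if "i < n" for i
    using pcas_nth[OF u(2) n(2)] that unfolding next_ind_def n_def[symmetric] by auto
  define M where "M = Max ((\<lambda>i. snd (es ! i)) ` {..<n})"
  have "M \<in> (\<lambda>i. snd (es ! i)) ` {..<n}" using n unfolding M_def by (intro Max_in) (auto simp: lessThan_empty_iff)
  then obtain i where i: "i < n" "snd (es ! i) = M" by auto
  have max: "snd (es ! l) \<le> snd (es ! i)" if "l < n" for l
    using that unfolding i(2) M_def by (intro Max_ge) auto
  define j where "j = (if i = 0 then n - 1 else i - 1)"
  have j: "j < n" "next_ind j = i" "next_ind i \<noteq> j"
    using i(1) n(1) unfolding j_def next_ind_def by (auto split: if_splits)
  have arc: "(0 < fst (es ! l) \<and> snd (es ! l) = p (fst (es ! l))) \<or>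
      (0 < snd (es ! l) \<and> fst (es ! l) = p (snd (es ! l)))" if "l < n" for l
    using u(1) nth_mem[of l es] that unfolding parent_tree_def n_def by (cases "es ! l") auto
  have "snd (es ! j) = p (snd (es ! i))"
    using arc[OF i(1)] succ[OF j(1)] max[OF j(1)] p[of "fst (es ! i)"] j(2) by auto
  moreover have "snd (es ! next_ind i) = p (snd (es ! i))"
    using arc[OF succ(2)[OF i(1)]] succ[OF i(1)] max[OF succ(2)[OF i(1)]]
      p[of "snd (es ! next_ind i)"] by auto
  \<comment> \<open>The vertices before and after the maximum are both its parent. Heads of the arcs
    of a cycle are distinct, so the positions agree, which \<open>3 <= n\<close> excludes.\<close>
  ultimately have "j = next_ind i"
    using nth_eq_iff_index_eq[OF dist, of j "next_ind i"] j(1) succ(2)[OF i(1)] unfolding n_def by simp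
  then show False using j(3) by simp
qed

lemma parent_tree_pair_graph:
  assumes p: "\<And>v. 0 < v \<Longrightarrow> p v < v"
  shows "pair_graph (parent_tree p m)"
proof -
  have sub: "parcs (parent_tree p m) \<subseteq> {..m} \<times> {..m}"
  proof (rule subrelI)
    fix a b assume "(a, b) \<in> parcs (parent_tree p m)"
    then show "(a, b) \<in> {..m} \<times> {..m}"
      using p[of a] p[of b] unfolding parent_tree_def by auto
  qed
  have irr: "a \<noteq> b" if "(a, b) \<in> parcs (parent_tree p m)" for a b
    using that p[of a] p[of b] unfolding parent_tree_def by auto
  have "sym (parcs (parent_tree p m))" unfolding parent_tree_def sym_def by auto
  moreover have "finite (parcs (parent_tree p m))" using finite_subset[OF sub] by simp
  moreover have "pverts (parent_tree p m) = {..m}" by (simp add: parent_tree_def)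
  ultimately show ?thesis
    using sub irr by unfold_locales (auto simp: symmetric_def)
qed

lemma parent_tree_is_tree:
  assumes p: "\<And>v. 0 < v \<Longrightarrow> p v < v"
  shows "is_tree (parent_tree p m)"
proof -
  let ?T = "parent_tree p m"
  interpret pair_graph ?T using parent_tree_pair_graph[OF p] .
  have arcs: "parcs (mk_symmetric (with_proj ?T)) = parcs ?T"
    by (auto simp: parcs_mk_symmetric parent_tree_def)
  have "(v, 0) \<in> rtrancl_on {..m} (parcs ?T) \<and> (0, v) \<in> rtrancl_on {..m} (parcs ?T)" if "v \<le> m" for v
    using that
  proof (induction v rule: less_induct)
    case (less v)
    show ?case
    proof (cases "v = 0")
      case False
      then have "p v < v" "(v, p v) \<in> parcs ?T" "(p v, v) \<in> parcs ?T"
        using p less.prems by (auto simp: parent_tree_def)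
      with less show ?thesis
        by (auto intro: converse_rtrancl_on_into_rtrancl_on rtrancl_on_into_rtrancl_on)
    qed simp
  qed
  then have "(u, v) \<in> rtrancl_on {..m} (parcs ?T)" if "u \<le> m" "v \<le> m" for u v
    using that rtrancl_on_trans by metis
  then have "connected (with_proj ?T)"
    unfolding connected_def strongly_connected_def reachable_def
    using arcs by (auto simp: parent_tree_def)
  then show ?thesis
    using parent_tree_acyclic[OF p, of m] parent_tree_pair_graph[OF p, of m]
    unfolding is_tree_def by (metis not_less)
qed

text \<open>The edge \<open>{v, p v}\<close> has \<open>v\<close> as its larger end, so edges and
  positive vertices match up.\<close>

lemma card_uedges_parent_tree:
  assumes p: "\<And>v. 0 < v \<Longrightarrow> p v < v"
  shows "card (uedges (parent_tree p m)) = m"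
proof -
  have "uedges (parent_tree p m) = (\<lambda>v. {v, p v}) ` {1..m}"
    unfolding uedges_def parent_tree_def by (force simp: image_iff)
  moreover have "inj_on (\<lambda>v. {v, p v}) {1..m}"
  proof (rule inj_onI)
    fix v w assume "v \<in> {1..m}" "w \<in> {1..m}" "{v, p v} = {w, p w}"
    then show "v = w" using p[of v] p[of w] by (auto simp: doubleton_eq_iff)
  qed
  ultimately show ?thesis by (simp add: card_image)
qed

text \<open>
  The vertices of \<open>spider q m\<close> other than the centre \<open>0\<close> form \<open>q\<close> legs, the residue classes modulo \<open>q\<close>.
\<close>
definition spider :: "nat \<Rightarrow> nat \<Rightarrow> nat pair_pre_digraph" where
  "spider q m = parent_tree (\<lambda>v. if v \<le> q then 0 else v - q) m"

lemma spider_arc: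
  assumes "0 < v" "v \<le> m"
  shows "v \<le> q \<Longrightarrow> (v, 0) \<in> parcs (spider q m)" "v \<le> q \<Longrightarrow> (0, v) \<in> parcs (spider q m)"
    "q < v \<Longrightarrow> (v, v - q) \<in> parcs (spider q m)" "q < v \<Longrightarrow> (v - q, v) \<in> parcs (spider q m)"
  using assms by (auto simp: spider_def parent_tree_def)

text \<open>While the centre stays, a round removes at most the last vertex of each leg, and
  \<open>v + j * q <= m\<close> says that at least \<open>j\<close> vertices follow \<open>v\<close>
  on its leg. The condition on \<open>j\<close> keeps 1 and 2 present at the start of the last
  round, so the centre survives it.\<close>

lemma spider_core_power:
  assumes q: "2 \<le> q" and j: "j = 0 \<or> 2 + (j - 1) * q \<le> m"
  shows "{v. v \<le> m \<and> (v = 0 \<or> v + j * q \<le> m)} \<subseteq> (core (parcs (spider q m)) ^^ j) {..m}"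
  using j
proof (induction j)
  case (Suc j)
  let ?F = "parcs (spider q m)" and ?D = "(core (parcs (spider q m)) ^^ j) {..m}"
  have j: "2 + j * q \<le> m" using Suc.prems by simp
  then have "j = 0 \<or> 2 + (j - 1) * q \<le> m" by (cases j) auto
  then have D: "v \<in> ?D" if "v \<le> m" "v = 0 \<or> v + j * q \<le> m" for v
    using Suc.IH that by auto
  have "v \<in> core ?F ?D" if v: "v \<le> m" "v = 0 \<or> v + Suc j * q \<le> m" for v
  proof (cases "v = 0")
    case True
    have "1 \<in> ?D" "2 \<in> ?D" "0 \<in> ?D" using D j by auto
    then show ?thesis
      using True j q spider_arc(2)[of 1 m q] spider_arc(2)[of 2 m q]
      by (intro coreI[of v ?D 1 2]) auto
  next
    case False
    then have v': "v + q + j * q \<le> m" using v by simp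
    then have "v - q + j * q \<le> m" by linarith
    with v' have in_D: "v \<in> ?D" "v + q \<in> ?D" "v - q \<in> ?D" "0 \<in> ?D" using D by auto
    show ?thesis
    proof (cases "v \<le> q")
      case True
      show ?thesis
        using False True q v' in_D spider_arc(1)[of v m q] spider_arc(4)[of "v + q" m q]
        by (intro coreI[of v ?D 0 "v + q"]) auto
    next
      case nle: False
      show ?thesis
        using False nle q v' in_D spider_arc(3)[of v m q] spider_arc(4)[of "v + q" m q]
        by (intro coreI[of v ?D "v - q" "v + q"]) auto
    qed
  qed
  then show ?case by auto
qed auto

lemma universal_spider_model:
  assumes T: "is_tree T" and univ: "universal_for_trees m T" and q: "0 < q"
  shows "\<exists>B. minor_model (parcs (spider q m)) ((core (parcs (spider q m)) ^^ n) {..m})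
    (parcs T) ((core (parcs T) ^^ n) (pverts T)) B"
proof -
  have par: "(if v \<le> q then 0 else v - q) < v" if "0 < v" for v using q that by simp
  have "is_minor (spider q m) T"
    using univ parent_tree_is_tree[OF par] card_uedges_parent_tree[OF par]
    unfolding universal_for_trees_def spider_def by blast
  moreover interpret pair_graph T using T unfolding is_tree_def by simp
  interpret H: pair_graph "spider q m" unfolding spider_def using parent_tree_pair_graph[OF par] .
  have "pverts (spider q m) = {..m}" unfolding spider_def parent_tree_def by simp
  moreover have "irrefl (parcs (spider q m))" using H.pair_no_loops unfolding irrefl_def by fastforce
  moreover have "sym (parcs T)" using pair_sym_arcs by (simp add: symmetric_def)
  ultimately show ?thesis
    using is_minor_imp_minor_model minor_model_core_power pair_graph_axioms by metis
qed

section \<open>The lower bound\<close>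

lemma card_parcs_le:
  assumes "finite (parcs T)" "sym (parcs T)"
  shows "card (parcs T) \<le> 2 * card (uedges T)"
proof -
  \<comment> \<open>\<open>X\<close> selects one arc for every edge; together with the reversed arcs
    it covers \<open>parcs T\<close>.\<close>
  obtain X where X: "X \<subseteq> parcs T" "inj_on (\<lambda>(u, v). {u, v}) X" "uedges T = (\<lambda>(u, v). {u, v}) ` X"
    using subset_image_inj[of "uedges T" "\<lambda>(u, v). {u, v}" "parcs T"] unfolding uedges_def by auto
  have fX: "finite X" using X(1) assms(1) finite_subset by blast
  have "parcs T \<subseteq> X \<union> X\<inverse>"
  proof
    fix e assume "e \<in> parcs T"
    then obtain u v where e: "e = (u, v)" "{u, v} \<in> uedges T" unfolding uedges_def by (cases e) force
    then obtain a b where "(a, b) \<in> X" "{u, v} = {a, b}" unfolding X(3) by auto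
    then show "e \<in> X \<union> X\<inverse>" unfolding e by (auto simp: doubleton_eq_iff)
  qed
  then have "card (parcs T) \<le> card (X \<union> X\<inverse>)" using fX by (intro card_mono) auto
  also have "\<dots> \<le> card X + card (X\<inverse>)" by (rule card_Un_le)
  also have "\<dots> = 2 * card (uedges T)" using X by (simp add: card_image)
  finally show ?thesis .
qed

text \<open>For \<open>m >= 2\<close>, the quotients with \<open>i > m div 2\<close> are all 1 and
  sum to \<open>m - m div 2 = m div 2 + m mod 2\<close>; omitting the term \<open>m div 2\<close> at
  2 leaves just \<open>m mod 2\<close> of this.\<close>

lemma sum_div_except_2:
  assumes "1 \<le> (m :: nat)"
  shows "(\<Sum>i \<in> {1..m} - {2}. m div i) = (\<Sum>i = 1..m div 2. m div i) + m mod 2"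
proof (cases "m = 1")
  case False
  then have m: "2 \<le> m" using assms by simp
  have "{1..m} = {1..m div 2} \<union> {m div 2 + 1..m}" by auto
  then have "(\<Sum>i = 1..m. m div i) = (\<Sum>i = 1..m div 2. m div i) + (\<Sum>i = m div 2 + 1..m. m div i)"
    by (simp add: sum.union_disjoint)
  also have "(\<Sum>i = m div 2 + 1..m. m div i) = (\<Sum>i = m div 2 + 1..m. 1)"
    by (intro sum.cong refl div_nat_eqI) auto
  finally have "(\<Sum>i = 1..m. m div i) = (\<Sum>i = 1..m div 2. m div i) + (m - m div 2)" by simp
  moreover have "(\<Sum>i = 1..m. m div i) = m div 2 + (\<Sum>i \<in> {1..m} - {2}. m div i)"
    using m by (intro sum.remove) auto
  moreover have "m - m div 2 = m div 2 + m mod 2" by presburger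
  ultimately show ?thesis by linarith
qed simp

theorem theorem3:
  fixes T :: "'a pair_pre_digraph" and m :: nat
  assumes "m \<ge> 1"
    and "is_tree T"
    and "universal_for_trees m T"
  shows "(\<Sum>i \<in> {1..m} - {2}. m div i) \<le> card (uedges T)"
proof -
  interpret pair_graph T using assms(2) unfolding is_tree_def by simp
  define E V where "E = parcs T" and "V = pverts T"
  define D where "D n = (core E ^^ n) V" for n
  have sym: "sym E" using pair_sym_arcs unfolding E_def by (simp add: symmetric_def)
  have irr: "irrefl E" using pair_no_loops unfolding E_def irrefl_def by fastforce
  have D_sub: "D n \<subseteq> V" for n unfolding D_def by (rule core_power_subset)
  have fin: "finite (D n)" for n using D_sub pair_finite_verts finite_subset unfolding V_def by blast
  have conn: "conn E (D n)" for n
    using conn_core_power[OF sym] connected_imp_conn(1)[of T] assms(2)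
    unfolding D_def E_def V_def is_tree_def by blast
  have model: "\<exists>B. minor_model (parcs (spider q m)) {v. v \<le> m \<and> (v = 0 \<or> v + j * q \<le> m)} E (D j) B"
    if q: "2 \<le> q" "j = 0 \<or> 2 + (j - 1) * q \<le> m" for q j
  proof -
    obtain B where "minor_model (parcs (spider q m)) ((core (parcs (spider q m)) ^^ j) {..m}) E (D j) B"
      using universal_spider_model[OF assms(2,3), of q j] q unfolding E_def V_def D_def by auto
    then show ?thesis using spider_core_power[OF q] minor_model_subset by blast
  qed
  have leaves: "arc_count E (D (Suc n)) (D (Suc n)) + 2 * (m div Suc n) \<le> arc_count E (D n) (D n)"
    if n: "Suc n \<le> m div 2" for n
  proof -
    define q where "q = m div Suc n"
    have q: "2 \<le> q" using n unfolding q_def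
      by (simp add: less_eq_div_iff_mult_less_eq mult.commute)
    \<comment> \<open>Every leg has at least \<open>Suc n\<close> vertices, so after
      \<open>n\<close> rounds the star formed by 0 and \<open>1, ..., q\<close> is left.\<close>
    have qm: "q + n * q \<le> m" using times_div_less_eq_dividend[of "Suc n" m] unfolding q_def by simp
    \<comment> \<open>The model one round later shows that the next core is nonempty: the centre
      still has a branch set.\<close>
    obtain B' where "minor_model (parcs (spider q m))
        {v. v \<le> m \<and> (v = 0 \<or> v + Suc n * q \<le> m)} E (D (Suc n)) B'"
      using model[of q "Suc n"] q qm by auto
    then have ne: "core E (D n) \<noteq> {}" unfolding minor_model_def D_def by auto
    have "n = 0 \<or> 2 + (n - 1) * q \<le> m" using q qm by (cases n) auto
    then obtain B where B: "minor_model (parcs (spider q m))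
        {v. v \<le> m \<and> (v = 0 \<or> v + n * q \<le> m)} E (D n) B"
      using model[of q n] q by blast
    have leg: "v \<le> m \<and> (v = 0 \<or> v + n * q \<le> m)" if "v \<le> q" for v using that qm by auto
    have C: "B 0 \<noteq> {}" "B 0 \<subseteq> D n" "conn E (B 0)"
      using B unfolding minor_model_def by auto
    \<comment> \<open>One arc is chosen from the branch set of the centre to the first branch set of
      each leg; disjointness makes them distinct, so \<open>q\<close> arcs leave the connected set
      \<open>B 0\<close>.\<close>
    have "\<exists>e. e \<in> E \<inter> B 0 \<times> B v" if v: "v \<in> {1..q}" for v
    proof -
      have "(0, v) \<in> parcs (spider q m)" using spider_arc(2)[of v m q] v leg[of v] by auto
      moreover have "0 \<noteq> v" using v by simp
      ultimately have "\<exists>a\<in>B 0. \<exists>b\<in>B v. (a, b) \<in> E"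
        using B leg[of v] leg[of 0] v unfolding minor_model_def by simp
      then show ?thesis by blast
    qed
    then obtain e where e: "\<And>v. v \<in> {1..q} \<Longrightarrow> e v \<in> E \<inter> B 0 \<times> B v" by metis
    have dj: "B v \<inter> B w = {}" if "v \<le> q" "w \<le> q" "v \<noteq> w" for v w
      using B leg[OF that(1)] leg[OF that(2)] that(3) unfolding minor_model_def by simp
    have sub: "B v \<subseteq> D n" if "v \<le> q" for v
      using B leg[OF that] unfolding minor_model_def by simp
    have "inj_on e {1..q}"
    proof (rule inj_onI)
      fix v w assume "v \<in> {1..q}" "w \<in> {1..q}" "e v = e w"
      then show "v = w" using e[of v] e[of w] dj[of v w] by (cases "v = w") auto
    qed
    moreover have "e ` {1..q} \<subseteq> E \<inter> B 0 \<times> (D n - B 0)"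
    proof
      fix x assume "x \<in> e ` {1..q}"
      then obtain v where v: "v \<in> {1..q}" "x = e v" by blast
      then show "x \<in> E \<inter> B 0 \<times> (D n - B 0)" using e[of v] dj[of v 0] sub[of v] by auto
    qed
    moreover have "finite (E \<inter> B 0 \<times> (D n - B 0))"
      using fin[of n] finite_subset[OF C(2)] by simp
    ultimately have "q \<le> arc_count E (B 0) (D n - B 0)"
      using card_inj_on_le[of e "{1..q}" "E \<inter> B 0 \<times> (D n - B 0)"] by simp
    also have "\<dots> \<le> card (D n - core E (D n))"
    proof (rule card_leaves_ge[OF sym fin _ _ C(3,2,1)])
      show "arc_count E (D n) (D n) + 2 \<le> 2 * card (D n)"
        using tree_arc_count[OF assms(2) fin[of n]] D_sub[of n] C unfolding E_def V_def by blast
      show "\<exists>w\<in>D n. (v, w) \<in> E" if "v \<in> D n" for v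
        using conn_neighbour[OF conn irr that ne] .
    qed
    finally show ?thesis
      using arc_count_core[OF sym irr fin conn ne] unfolding q_def D_def by simp
  qed
  \<comment> \<open>The arc counts telescope over the rounds; the step from \<open>D n\<close>
    supplies the term \<open>i = Suc n\<close>.\<close>
  have "arc_count E (D n) (D n) + 2 * (\<Sum>i = 1..n. m div i) \<le> arc_count E (D 0) (D 0)"
    if "n \<le> m div 2" for n
    using that
  proof (induction n)
    case (Suc n)
    then show ?case using leaves[of n] by simp
  qed simp
  moreover have "2 * (m mod 2) \<le> arc_count E (D (m div 2)) (D (m div 2))"
  proof (cases "even m")
    case False
    define k where "k = m div 2"
    have k: "m = 2 * k + 1" using False unfolding k_def by presburger
    \<comment> \<open>\<open>spider 2 m\<close> is the path with \<open>m\<close> edges; since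
      \<open>1 + k * 2 = m\<close>, its vertices 0 and 1 survive \<open>k\<close> rounds, and an
      edge of \<open>T\<close> joins their branch sets.\<close>
    obtain B where B: "minor_model (parcs (spider 2 m)) {v. v \<le> m \<and> (v = 0 \<or> v + k * 2 \<le> m)} E (D k) B"
      using model[of 2 k] k by (cases k) auto
    have "(0, 1) \<in> parcs (spider 2 m)" using spider_arc(2)[of 1 m 2] assms(1) by simp
    then have "\<exists>a\<in>B 0. \<exists>b\<in>B 1. (a, b) \<in> E"
      using B k unfolding minor_model_def by simp
    then obtain a b where ab: "a \<in> B 0" "b \<in> B 1" "(a, b) \<in> E" by blast
    have "B 0 \<subseteq> D k" "B 1 \<subseteq> D k" using B k unfolding minor_model_def by auto
    moreover have "(b, a) \<in> E" using sym ab(3) by (rule symD)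
    moreover have "a \<noteq> b" using irr ab(3) unfolding irrefl_def by auto
    ultimately have "{(a, b), (b, a)} \<subseteq> E \<inter> D k \<times> D k" "card {(a, b), (b, a)} = 2"
      using ab by auto
    then have "2 \<le> arc_count E (D k) (D k)"
      using card_mono[of "E \<inter> D k \<times> D k" "{(a, b), (b, a)}"] fin[of k] by simp
    then show ?thesis using k unfolding k_def[symmetric] by simp
  qed simp
  moreover have "E \<inter> D 0 \<times> D 0 = E"
    unfolding D_def E_def V_def by (auto dest: in_arcsD1 in_arcsD2)
  moreover have "card E \<le> 2 * card (uedges T)"
    using card_parcs_le[of T] sym unfolding E_def by simp
  ultimately show ?thesis using sum_div_except_2[OF assms(1)] by fastforce
qed

end
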